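(* Let $E$ be a complex Banach space and $B_E$ its open unit ball. Then $H^\infty(B_E)\subset\mathcal{B}_{nat}(B_E)$ and the inclusion map $Id:(H^\infty(B_E),\|\cdot\|_\infty)\to(\mathcal{B}_{nat}(B_E),\|\cdot\|_{nat-Bloch})$ is continuous.
   Context: $H(B_E)$ is the space of holomorphic (complex Fréchet differentiable) functions $f:B_E\to\mathbb{C}$; $H^\infty(B_E)$ is the space of bounded functions in $H(B_E)$ with $\|f\|_\infty=\sup_{x\in B_E}|f(x)|$. For $f\in H(B_E)$ put $\|f\|_{nat}=\sup_{x\in B_E}(1-\|x\|^2)\|f'(x)\|$, where $f'(x)\in E^*$ has the dual norm. $\mathcal{B}_{nat}(B_E)=\{f\in H(B_E):\|f\|_{nat}<\infty\}$, normed by $\|f\|_{nat-Bloch}=|f(0)|+\|f\|_{nat}$. *)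

theory Defs
  imports "HOL-Analysis.Analysis"
begin

class complex_banach = banach +
  fixes scaleC :: "complex \<Rightarrow> 'a \<Rightarrow> 'a"  (infixr \<open>*\<^sub>C\<close> 75)
  assumes scaleC_add_right: "c *\<^sub>C (x + y) = c *\<^sub>C x + c *\<^sub>C y"
    and scaleC_add_left: "(c + d) *\<^sub>C x = c *\<^sub>C x + d *\<^sub>C x"
    and scaleC_scaleC: "c *\<^sub>C (d *\<^sub>C x) = (c * d) *\<^sub>C x"
    and scaleC_of_real: "complex_of_real r *\<^sub>C x = r *\<^sub>R x"
    and norm_scaleC: "norm (c *\<^sub>C x) = cmod c * norm x"

instantiation complex :: complex_banach
begin

definition scaleC_complex :: "complex \<Rightarrow> complex \<Rightarrow> complex" where
  "scaleC_complex c x = c * x"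

instance
  by standard (simp_all add: scaleC_complex_def algebra_simps norm_mult scaleR_conv_of_real)

end

text \<open>
  A function on the open unit ball \<open>ball 0 1\<close> is represented by a total function that is
  \<^const>\<open>extensional\<close> (\<open>undefined\<close> off the ball), so that equality is equality on the ball.
  The derivative at a point of the ball does not depend on the values outside.
\<close>

definition holo_ball :: "('a::complex_banach \<Rightarrow> complex) set" where
  "holo_ball = {f \<in> extensional (ball 0 1). \<forall>x\<in>ball 0 1. \<exists>D.
     (f has_derivative D) (at x) \<and> (\<forall>c h. D (c *\<^sub>C h) = c * D h)}"

definition sup_norm :: "('a::complex_banach \<Rightarrow> complex) \<Rightarrow> real" where
  "sup_norm f = (SUP x\<in>ball 0 1. cmod (f x))"

definition Hinf :: "('a::complex_banach \<Rightarrow> complex) set" where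
  "Hinf = {f \<in> holo_ball. bounded (f ` ball 0 1)}"

text \<open>
  \<^const>\<open>onorm\<close> is the norm of \<open>f'(x)\<close> in the dual of \<open>E\<close>. The real-valued suprema
  here and in \<open>sup_norm\<close> are meaningful only for bounded families, which membership in
  the respective space guarantees.
\<close>

definition nat_weight :: "('a::complex_banach \<Rightarrow> complex) \<Rightarrow> 'a \<Rightarrow> real" where
  "nat_weight f x = (1 - (norm x)\<^sup>2) * onorm (frechet_derivative f (at x))"

definition nat_seminorm :: "('a::complex_banach \<Rightarrow> complex) \<Rightarrow> real" where
  "nat_seminorm f = (SUP x\<in>ball 0 1. nat_weight f x)"

definition Bnat :: "('a::complex_banach \<Rightarrow> complex) set" where
  "Bnat = {f \<in> holo_ball. bdd_above (nat_weight f ` ball 0 1)}"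

definition nat_Bloch_norm :: "('a::complex_banach \<Rightarrow> complex) \<Rightarrow> real" where
  "nat_Bloch_norm f = cmod (f 0) + nat_seminorm f"

definition ball_diff ::
    "('a::complex_banach \<Rightarrow> complex) \<Rightarrow> ('a \<Rightarrow> complex) \<Rightarrow> 'a \<Rightarrow> complex" where
  "ball_diff f g = (\<lambda>x\<in>ball 0 1. f x - g x)"

text \<open>
  The metric of a norm \<open>N\<close> on a space \<open>M\<close> of functions on the ball. It is cut off to \<open>0\<close>
  outside \<open>M\<close> because \<^locale>\<open>Metric_space\<close> requires symmetry and nonnegativity on the
  whole type; the topology depends only on its values on \<open>M\<close>.
\<close>

definition norm_metric ::
    "('a::complex_banach \<Rightarrow> complex) set \<Rightarrow> (('a \<Rightarrow> complex) \<Rightarrow> real)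
      \<Rightarrow> ('a \<Rightarrow> complex) \<Rightarrow> ('a \<Rightarrow> complex) \<Rightarrow> real" where
  "norm_metric M N f g = (if f \<in> M \<and> g \<in> M then N (ball_diff f g) else 0)"

definition norm_topology ::
    "('a::complex_banach \<Rightarrow> complex) set \<Rightarrow> (('a \<Rightarrow> complex) \<Rightarrow> real)
      \<Rightarrow> ('a \<Rightarrow> complex) topology" where
  "norm_topology M N = Metric_space.mtopology M (norm_metric M N)"


lemma holo_ball_has_derivative:
  assumes "f \<in> holo_ball" "x \<in> ball 0 1"
  shows "(f has_derivative frechet_derivative f (at x)) (at x)"
proof -
  have "f differentiable (at x)"
    using assms unfolding holo_ball_def differentiable_def by blast
  then show ?thesis by (simp only: frechet_derivative_works)
qed

lemma holo_ball_derivative_scaleC: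
  assumes "f \<in> holo_ball" "x \<in> ball 0 1"
  shows "frechet_derivative f (at x) (c *\<^sub>C h) = c * frechet_derivative f (at x) h"
proof -
  obtain D where D: "(f has_derivative D) (at x)" "\<forall>c h. D (c *\<^sub>C h) = c * D h"
    using assms unfolding holo_ball_def by blast
  from D(2) show ?thesis unfolding frechet_derivative_at[OF D(1), symmetric] by blast
qed

lemma ball_diff_has_derivative:
  assumes "f \<in> holo_ball" "g \<in> holo_ball" "x \<in> ball 0 1"
  shows "(ball_diff f g has_derivative
           (\<lambda>h. frechet_derivative f (at x) h - frechet_derivative g (at x) h)) (at x)"
proof (rule has_derivative_transform_within_open[where s = "ball 0 1"])
  show "((\<lambda>x. f x - g x) has_derivative
           (\<lambda>h. frechet_derivative f (at x) h - frechet_derivative g (at x) h)) (at x)"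
    using assms by (intro has_derivative_diff holo_ball_has_derivative)
qed (use assms in \<open>auto simp: ball_diff_def\<close>)

lemma ball_diff_holo:
  assumes "f \<in> holo_ball" "g \<in> holo_ball"
  shows "ball_diff f g \<in> holo_ball"
proof -
  have "\<exists>D. (ball_diff f g has_derivative D) (at x) \<and> (\<forall>c h. D (c *\<^sub>C h) = c * D h)"
    if "x \<in> ball 0 1" for x
    by (rule exI, rule conjI, rule ball_diff_has_derivative[OF assms that])
      (simp add: holo_ball_derivative_scaleC[OF assms(1) that]
        holo_ball_derivative_scaleC[OF assms(2) that] right_diff_distrib)
  then show ?thesis
    unfolding holo_ball_def by (auto simp: ball_diff_def)
qed

lemma ball_diff_frechet:
  assumes "f \<in> holo_ball" "g \<in> holo_ball" "x \<in> ball 0 1"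
  shows "frechet_derivative (ball_diff f g) (at x) =
           (\<lambda>h. frechet_derivative f (at x) h - frechet_derivative g (at x) h)"
  by (rule frechet_derivative_at[OF ball_diff_has_derivative[OF assms], symmetric])

lemma nat_weight_nonneg:
  assumes "f \<in> holo_ball" "x \<in> ball 0 1"
  shows "0 \<le> nat_weight f x"
proof -
  have "bounded_linear (frechet_derivative f (at x))"
    using holo_ball_has_derivative[OF assms] by (rule has_derivative_bounded_linear)
  moreover have "(norm x)\<^sup>2 \<le> 1"
    using assms(2) by (simp add: abs_square_le_1)
  ultimately show ?thesis
    unfolding nat_weight_def by (simp add: onorm_pos_le)
qed

lemma nat_weight_ball_diff:
  assumes "f \<in> holo_ball" "g \<in> holo_ball" "x \<in> ball 0 1"
  shows "nat_weight (ball_diff f g) x \<le> nat_weight f x + nat_weight g x"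
proof -
  have bl: "bounded_linear (frechet_derivative f (at x))"
           "bounded_linear (frechet_derivative g (at x))"
    using assms holo_ball_has_derivative has_derivative_bounded_linear by blast+
  have "onorm (frechet_derivative (ball_diff f g) (at x))
      \<le> onorm (frechet_derivative f (at x)) + onorm (frechet_derivative g (at x))"
    using onorm_triangle[OF bl(1) bounded_linear_minus[OF bl(2)]]
    by (simp add: ball_diff_frechet[OF assms] onorm_neg)
  moreover have "0 \<le> 1 - (norm x)\<^sup>2"
    using assms(3) by (simp add: abs_square_le_1)
  ultimately show ?thesis
    unfolding nat_weight_def by (metis distrib_left mult_left_mono)
qed

lemma ball_diff_Hinf:
  assumes "f \<in> Hinf" "g \<in> Hinf"
  shows "ball_diff f g \<in> Hinf"
proof -
  have "bounded ((\<lambda>x. f x - g x) ` ball 0 1)"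
    using assms bounded_minus_comp unfolding Hinf_def by blast
  then have "bounded (ball_diff f g ` ball 0 1)"
    by (metis (no_types, lifting) ball_diff_def image_cong restrict_apply')
  then show ?thesis using assms ball_diff_holo by (auto simp: Hinf_def)
qed

lemma ball_diff_Bnat:
  assumes "f \<in> Bnat" "g \<in> Bnat"
  shows "ball_diff f g \<in> Bnat"
proof -
  obtain a b where "\<forall>x\<in>ball 0 1. nat_weight f x \<le> a" "\<forall>x\<in>ball 0 1. nat_weight g x \<le> b"
    using assms unfolding Bnat_def bdd_above_def by auto
  then have "\<forall>x\<in>ball 0 1. nat_weight (ball_diff f g) x \<le> a + b"
    using assms nat_weight_ball_diff unfolding Bnat_def by (smt (verit) mem_Collect_eq)
  then have "bdd_above (nat_weight (ball_diff f g) ` ball 0 1)"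
    by (auto intro!: bdd_aboveI)
  then show ?thesis using assms ball_diff_holo by (auto simp: Bnat_def)
qed

lemma sup_norm_upper:
  assumes "f \<in> Hinf" "x \<in> ball 0 1"
  shows "cmod (f x) \<le> sup_norm f"
proof -
  obtain M where "\<forall>y\<in>ball 0 1. cmod (f y) \<le> M"
    using assms(1) unfolding Hinf_def bounded_iff by auto
  then have "bdd_above ((\<lambda>x. cmod (f x)) ` ball 0 1)"
    by (intro bdd_aboveI2) blast
  then show ?thesis unfolding sup_norm_def using assms(2) by (rule cSUP_upper2) simp
qed

lemma nat_seminorm_upper:
  assumes "f \<in> Bnat" "x \<in> ball 0 1"
  shows "nat_weight f x \<le> nat_seminorm f"
  using assms unfolding nat_seminorm_def Bnat_def by (auto intro: cSUP_upper)

lemma Metric_space_Hinf: "Metric_space Hinf (norm_metric Hinf sup_norm)"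
proof
  have 0: "(0::'a) \<in> ball 0 1" by simp
  fix f g h :: "'a \<Rightarrow> complex"
  show "0 \<le> norm_metric Hinf sup_norm f g"
    using order_trans[OF norm_ge_zero sup_norm_upper[OF ball_diff_Hinf 0]]
    by (simp add: norm_metric_def)
  show "norm_metric Hinf sup_norm f g = norm_metric Hinf sup_norm g f"
    by (auto simp: norm_metric_def sup_norm_def ball_diff_def norm_minus_commute
        intro!: SUP_cong)
  show "norm_metric Hinf sup_norm f g = 0 \<longleftrightarrow> f = g" if "f \<in> Hinf" "g \<in> Hinf"
  proof
    assume "norm_metric Hinf sup_norm f g = 0"
    then have "cmod (ball_diff f g x) \<le> 0" if "x \<in> ball 0 1" for x
      using sup_norm_upper[OF ball_diff_Hinf[OF \<open>f \<in> Hinf\<close> \<open>g \<in> Hinf\<close>] that]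
        \<open>f \<in> Hinf\<close> \<open>g \<in> Hinf\<close> by (simp add: norm_metric_def)
    then have "f x = g x" if "x \<in> ball 0 1" for x
      using that by (auto simp: ball_diff_def)
    then show "f = g"
      using \<open>f \<in> Hinf\<close> \<open>g \<in> Hinf\<close> extensionalityI unfolding Hinf_def holo_ball_def by blast
  qed (simp add: norm_metric_def sup_norm_def ball_diff_def)
  show "norm_metric Hinf sup_norm f h
      \<le> norm_metric Hinf sup_norm f g + norm_metric Hinf sup_norm g h"
    if M: "f \<in> Hinf" "g \<in> Hinf" "h \<in> Hinf"
  proof -
    have "cmod (ball_diff f h x) \<le> sup_norm (ball_diff f g) + sup_norm (ball_diff g h)"
      if x: "x \<in> ball 0 1" for x
    proof -
      have "ball_diff f h x = ball_diff f g x + ball_diff g h x"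
        using x by (simp add: ball_diff_def)
      then show ?thesis
        using norm_triangle_mono[OF sup_norm_upper[OF ball_diff_Hinf[OF M(1,2)] x]
            sup_norm_upper[OF ball_diff_Hinf[OF M(2,3)] x]] by simp
    qed
    then have "sup_norm (ball_diff f h) \<le> sup_norm (ball_diff f g) + sup_norm (ball_diff g h)"
      unfolding sup_norm_def[of "ball_diff f h"] by (intro cSUP_least) auto
    with M show ?thesis by (simp add: norm_metric_def)
  qed
qed

lemma Metric_space_Bnat: "Metric_space Bnat (norm_metric Bnat nat_Bloch_norm)"
proof
  have 0: "(0::'a) \<in> ball 0 1" by simp
  have semi_nonneg: "0 \<le> nat_seminorm f" if "f \<in> Bnat" for f :: "'a \<Rightarrow> complex"
    using nat_seminorm_upper[OF that 0] nat_weight_nonneg[OF _ 0, of f] that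
    unfolding Bnat_def by simp
  fix f g h :: "'a \<Rightarrow> complex"
  show "0 \<le> norm_metric Bnat nat_Bloch_norm f g"
    using semi_nonneg[OF ball_diff_Bnat] by (simp add: norm_metric_def nat_Bloch_norm_def)
  have comm: "nat_weight (ball_diff f g) x = nat_weight (ball_diff g f) x"
    if "f \<in> Bnat" "g \<in> Bnat" "x \<in> ball 0 1" for x
  proof -
    have "frechet_derivative (ball_diff f g) (at x)
        = (\<lambda>h. - frechet_derivative (ball_diff g f) (at x) h)"
      using that by (simp add: ball_diff_frechet Bnat_def)
    then show ?thesis by (simp add: nat_weight_def onorm_neg)
  qed
  show "norm_metric Bnat nat_Bloch_norm f g = norm_metric Bnat nat_Bloch_norm g f"
    using comm by (auto simp: norm_metric_def nat_Bloch_norm_def nat_seminorm_def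
        ball_diff_def norm_minus_commute cong: SUP_cong_simp)
  show "norm_metric Bnat nat_Bloch_norm f g = 0 \<longleftrightarrow> f = g" if M: "f \<in> Bnat" "g \<in> Bnat"
  proof
    assume "norm_metric Bnat nat_Bloch_norm f g = 0"
    then have z: "cmod (ball_diff f g 0) = 0" "nat_seminorm (ball_diff f g) = 0"
      using semi_nonneg[OF ball_diff_Bnat[OF M]] M
      by (auto simp: norm_metric_def nat_Bloch_norm_def add_nonneg_eq_0_iff)
    have d: "(ball_diff f g has_derivative (\<lambda>h. 0)) (at x within ball 0 1)"
      if x: "x \<in> ball 0 1" for x
    proof -
      have H: "ball_diff f g \<in> holo_ball" using ball_diff_Bnat[OF M] by (simp add: Bnat_def)
      have bl: "bounded_linear (frechet_derivative (ball_diff f g) (at x))"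
        using holo_ball_has_derivative[OF H x] by (rule has_derivative_bounded_linear)
      have "(1 - (norm x)\<^sup>2) * onorm (frechet_derivative (ball_diff f g) (at x)) \<le> 0"
        using nat_seminorm_upper[OF ball_diff_Bnat[OF M] x] z by (simp add: nat_weight_def)
      moreover have "0 < 1 - (norm x)\<^sup>2"
        using x by (simp add: abs_square_less_1)
      ultimately have "onorm (frechet_derivative (ball_diff f g) (at x)) = 0"
        using onorm_pos_le[OF bl] by (simp add: mult_le_0_iff)
      then have "frechet_derivative (ball_diff f g) (at x) = (\<lambda>h. 0)"
        using onorm_eq_0[OF bl] by auto
      then show ?thesis
        using holo_ball_has_derivative[OF H x] has_derivative_at_withinI by metis
    qed
    have "ball_diff f g x = 0" if "x \<in> ball 0 1" for x
      using has_derivative_zero_unique[OF convex_ball d that 0] z(1) by (metis norm_eq_zero)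
    then have "f x = g x" if "x \<in> ball 0 1" for x
      using that by (simp add: ball_diff_def)
    then show "f = g"
      using M extensionalityI unfolding Bnat_def holo_ball_def by blast
  next
    assume [simp]: "f = g"
    have "frechet_derivative (ball_diff f f) (at x) = (\<lambda>h. 0)" if "x \<in> ball 0 1" for x
      using M that by (subst ball_diff_frechet) (auto simp: Bnat_def)
    then have "nat_weight (ball_diff f f) x = 0" if "x \<in> ball 0 1" for x
      using that by (simp add: nat_weight_def onorm_zero)
    then have "nat_seminorm (ball_diff f f) = (SUP x\<in>ball (0::'a) 1. 0)"
      unfolding nat_seminorm_def by (intro SUP_cong) auto
    then have "nat_seminorm (ball_diff f f) = 0"
      by simp
    then show "norm_metric Bnat nat_Bloch_norm f g = 0"
      by (simp add: norm_metric_def nat_Bloch_norm_def) (simp add: ball_diff_def)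
  qed
  show "norm_metric Bnat nat_Bloch_norm f h
      \<le> norm_metric Bnat nat_Bloch_norm f g + norm_metric Bnat nat_Bloch_norm g h"
    if M: "f \<in> Bnat" "g \<in> Bnat" "h \<in> Bnat"
  proof -
    have w: "nat_weight (ball_diff f h) x
        \<le> nat_seminorm (ball_diff f g) + nat_seminorm (ball_diff g h)"
      if x: "x \<in> ball 0 1" for x
    proof -
      have H: "f \<in> holo_ball" "g \<in> holo_ball" "h \<in> holo_ball"
        using M by (simp_all add: Bnat_def)
      have bl: "bounded_linear (frechet_derivative (ball_diff f g) (at x))"
               "bounded_linear (frechet_derivative (ball_diff g h) (at x))"
        using holo_ball_has_derivative[OF ball_diff_holo x] H has_derivative_bounded_linear
        by blast+
      have "frechet_derivative (ball_diff f h) (at x) = (\<lambda>v.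
          frechet_derivative (ball_diff f g) (at x) v + frechet_derivative (ball_diff g h) (at x) v)"
        using H x by (simp add: ball_diff_frechet)
      then have "onorm (frechet_derivative (ball_diff f h) (at x))
          \<le> onorm (frechet_derivative (ball_diff f g) (at x))
            + onorm (frechet_derivative (ball_diff g h) (at x))"
        using onorm_triangle[OF bl] by simp
      moreover have "0 \<le> 1 - (norm x)\<^sup>2"
        using x by (simp add: abs_square_le_1)
      ultimately have "nat_weight (ball_diff f h) x
          \<le> nat_weight (ball_diff f g) x + nat_weight (ball_diff g h) x"
        unfolding nat_weight_def by (metis distrib_left mult_left_mono)
      then show ?thesis
        using add_mono[OF nat_seminorm_upper[OF ball_diff_Bnat[OF M(1,2)] x]
            nat_seminorm_upper[OF ball_diff_Bnat[OF M(2,3)] x]] by linarith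
    qed
    have "nat_seminorm (ball_diff f h)
        \<le> nat_seminorm (ball_diff f g) + nat_seminorm (ball_diff g h)"
      unfolding nat_seminorm_def[of "ball_diff f h"] by (intro cSUP_least w) auto
    moreover have "cmod (ball_diff f h 0) \<le> cmod (ball_diff f g 0) + cmod (ball_diff g h 0)"
      using norm_triangle_ineq[of "ball_diff f g 0" "ball_diff g h 0"]
      by (simp add: ball_diff_def)
    ultimately show ?thesis using M by (simp add: norm_metric_def nat_Bloch_norm_def)
  qed
qed

end

theory Submission
  imports Defs "HOL-Complex_Analysis.Cauchy_Integral_Formula"
begin

text \<open>
  Restricting \<open>f\<close> to the complex line through \<open>x\<close> in direction \<open>h\<close> gives a holomorphic function on
  the disc of radius \<open>(1 - \<parallel>x\<parallel>) / \<parallel>h\<parallel>\<close>, so Cauchy's inequality yields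
  \<open>(1 - \<parallel>x\<parallel>) \<parallel>f'(x)\<parallel> \<le> \<parallel>f\<parallel>\<^sub>\<infinity>\<close>. Since \<open>1 - \<parallel>x\<parallel>\<^sup>2 \<le> 2 (1 - \<parallel>x\<parallel>)\<close>, the inclusion is linear with
  norm at most \<open>3\<close>.
\<close>

text \<open>Makes complex lines \<open>w \<mapsto> x + w *\<^sub>C h\<close> differentiable, as the
  chain rule below requires.\<close>

lemma bounded_linear_scaleC_left: "bounded_linear (\<lambda>z. z *\<^sub>C (h::'a::complex_banach))"
proof (rule bounded_linear_intro[where K = "norm h"])
  fix z w :: complex and r :: real
  show "(z + w) *\<^sub>C h = z *\<^sub>C h + w *\<^sub>C h" by (rule scaleC_add_left)
  \<comment> \<open>Real scaling on both sides is rewritten as \<open>*\<^sub>C\<close> by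
    \<open>complex_of_real r\<close>; on \<open>complex\<close> itself \<open>*\<^sub>C\<close> is
    multiplication.\<close>
  show "(r *\<^sub>R z) *\<^sub>C h = r *\<^sub>R (z *\<^sub>C h)"
    by (simp add: scaleC_of_real[symmetric] scaleC_scaleC scaleC_complex_def)
  show "norm (z *\<^sub>C h) \<le> norm z * norm h" by (simp add: norm_scaleC)
qed

text \<open>Chain rule; complex homogeneity of the Frechet derivative turns the resulting
  real-linear map into multiplication by a complex number.\<close>

lemma has_field_derivative_line:
  fixes f :: "'a::complex_banach \<Rightarrow> complex"
  assumes "f \<in> holo_ball" "x + z *\<^sub>C h \<in> ball 0 1"
  shows "((\<lambda>w. f (x + w *\<^sub>C h)) has_field_derivative
           frechet_derivative f (at (x + z *\<^sub>C h)) h) (at z)"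
proof -
  have "((\<lambda>w. x + w *\<^sub>C h) has_derivative (\<lambda>w. 0 + w *\<^sub>C h)) (at z)"
    by (intro has_derivative_add has_derivative_const
        bounded_linear_imp_has_derivative bounded_linear_scaleC_left)
  from has_derivative_compose[OF this holo_ball_has_derivative[OF assms]]
  have "((\<lambda>w. f (x + w *\<^sub>C h)) has_derivative
           (\<lambda>w. frechet_derivative f (at (x + z *\<^sub>C h)) (w *\<^sub>C h))) (at z)"
    by simp
  then show ?thesis
    by (simp add: has_field_derivative_def holo_ball_derivative_scaleC[OF assms]
        mult_commute_abs)
qed

text \<open>Cauchy's inequality for the first derivative at 0 of
  \<open>z \<mapsto> f (x + z *\<^sub>C h)\<close>; by the triangle inequality, the strict bound
  keeps the image of the closed disc of radius \<open>s\<close> inside the open ball.\<close>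

lemma cauchy_estimate_line:
  fixes f :: "'a::complex_banach \<Rightarrow> complex"
  assumes f: "f \<in> Hinf" and s: "0 < s" "norm x + s * norm h < 1"
  shows "s * cmod (frechet_derivative f (at x) h) \<le> sup_norm f"
proof -
  have H: "f \<in> holo_ball" using f by (simp add: Hinf_def)
  define g where "g = (\<lambda>z. f (x + z *\<^sub>C h))"
  have inb: "x + z *\<^sub>C h \<in> ball 0 1" if "cmod z \<le> s" for z
  proof -
    have "norm (x + z *\<^sub>C h) \<le> norm x + cmod z * norm h"
      using norm_triangle_ineq[of x "z *\<^sub>C h"] by (simp add: norm_scaleC)
    also have "\<dots> \<le> norm x + s * norm h"
      using that by (simp add: mult_right_mono)
    finally show ?thesis using s by simp
  qed
  have d: "(g has_field_derivative frechet_derivative f (at (x + z *\<^sub>C h)) h) (at z)"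
    if "cmod z \<le> s" for z
    unfolding g_def using H inb[OF that] by (rule has_field_derivative_line)
  have hol: "g holomorphic_on cball 0 s"
    unfolding holomorphic_on_def field_differentiable_def
    by (meson d has_field_derivative_at_within mem_cball_0)
  have "norm ((deriv ^^ 1) g 0) \<le> fact 1 * sup_norm f / s ^ 1"
  proof (rule Cauchy_inequality)
    show "g holomorphic_on ball 0 s" using hol ball_subset_cball holomorphic_on_subset by blast
    show "continuous_on (cball 0 s) g" using hol by (rule holomorphic_on_imp_continuous_on)
    show "cmod (g z) \<le> sup_norm f" if "cmod (0 - z) = s" for z
      unfolding g_def by (rule sup_norm_upper[OF f inb]) (use that in simp)
  qed (fact s)
  \<comment> \<open>Identifies the base point \<open>x + 0 *\<^sub>C h\<close> with
    \<open>x\<close>.\<close>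
  moreover have "0 *\<^sub>C h = 0" using scaleC_of_real[of 0 h] by simp
  then have "deriv g 0 = frechet_derivative f (at x) h"
    using DERIV_imp_deriv[OF d[of 0]] s by simp
  ultimately show ?thesis using s by (simp add: field_simps)
qed

lemma onorm_frechet_derivative_le:
  fixes f :: "'a::complex_banach \<Rightarrow> complex"
  assumes f: "f \<in> Hinf" and x: "x \<in> ball 0 1"
  shows "onorm (frechet_derivative f (at x)) \<le> sup_norm f / (1 - norm x)"
proof (rule onorm_bound)
  have x1: "0 < 1 - norm x" using x by simp
  have "0 \<le> sup_norm f" using norm_ge_zero sup_norm_upper[OF f x] by (rule order_trans)
  then show "0 \<le> sup_norm f / (1 - norm x)" using x1 by simp
  fix h :: 'a
  show "norm (frechet_derivative f (at x) h) \<le> sup_norm f / (1 - norm x) * norm h"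
  proof (cases "h = 0")
    case True
    have "linear (frechet_derivative f (at x))"
      using holo_ball_has_derivative[of f x] f x has_derivative_linear by (auto simp: Hinf_def)
    then show ?thesis using True by (simp add: linear_0)
  next
    case False
    have "(1 - norm x) / norm h * cmod (frechet_derivative f (at x) h) \<le> sup_norm f"
    \<comment> \<open>At the full radius \<open>(1 - norm x) / norm h\<close> the closed disc may
      touch the unit sphere, so the radius is shrunk by a factor \<open>t < 1\<close>, and
      \<open>t\<close> then tends to 1.\<close>
    proof (rule field_le_mult_one_interval)
      fix t :: real assume t: "0 < t" "t < 1"
      have "t * (1 - norm x) < 1 * (1 - norm x)" using t(2) x1 by (rule mult_strict_right_mono)
      then have "norm x + t * (1 - norm x) < 1" by (simp only: mult_1_left less_diff_eq add.commute)
      then have "t * (1 - norm x) / norm h * cmod (frechet_derivative f (at x) h) \<le> sup_norm f"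
        using t x1 False by (intro cauchy_estimate_line[OF f]) auto
      then show "t * ((1 - norm x) / norm h * cmod (frechet_derivative f (at x) h)) \<le> sup_norm f"
        by (simp add: mult.assoc)
    qed
    then show ?thesis using x1 False by (simp add: field_simps)
  qed
qed

lemma nat_weight_le_sup_norm:
  fixes f :: "'a::complex_banach \<Rightarrow> complex"
  assumes f: "f \<in> Hinf" and x: "x \<in> ball 0 1"
  shows "nat_weight f x \<le> 2 * sup_norm f"
proof -
  have x1: "0 < 1 - norm x" using x by simp
  have s0: "0 \<le> sup_norm f" using norm_ge_zero sup_norm_upper[OF f x] by (rule order_trans)
  \<comment> \<open>The factor \<open>1 - norm x\<close> cancels the denominator of the derivative
    bound; the other factor is at most 2.\<close>
  have sq: "1 - (norm x)\<^sup>2 = (1 + norm x) * (1 - norm x)"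
    by (simp add: power2_eq_square algebra_simps)
  have "nat_weight f x \<le> (1 - (norm x)\<^sup>2) * (sup_norm f / (1 - norm x))"
    unfolding nat_weight_def
    using x1 by (intro mult_left_mono onorm_frechet_derivative_le f x) (simp add: sq)
  also have "\<dots> = (1 + norm x) * sup_norm f"
    using x1 by (simp add: sq)
  also have "\<dots> \<le> 2 * sup_norm f"
    using x1 s0 by (intro mult_right_mono) auto
  finally show ?thesis .
qed

lemma Hinf_subset_Bnat: "Hinf \<subseteq> Bnat"
proof
  fix f :: "'a \<Rightarrow> complex" assume f: "f \<in> Hinf"
  have "bdd_above (nat_weight f ` ball 0 1)"
    using nat_weight_le_sup_norm[OF f] by (rule bdd_aboveI2)
  then show "f \<in> Bnat" using f by (simp add: Bnat_def Hinf_def)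
qed

text \<open>The constant is 1 for the value at 0 plus 2 for the seminorm.\<close>

lemma nat_Bloch_norm_le_sup_norm:
  fixes f :: "'a::complex_banach \<Rightarrow> complex"
  assumes f: "f \<in> Hinf"
  shows "nat_Bloch_norm f \<le> 3 * sup_norm f"
proof -
  have "nat_seminorm f \<le> 2 * sup_norm f"
    unfolding nat_seminorm_def by (intro cSUP_least nat_weight_le_sup_norm[OF f]) auto
  moreover have "cmod (f 0) \<le> sup_norm f" by (rule sup_norm_upper[OF f]) simp
  ultimately show ?thesis by (simp add: nat_Bloch_norm_def)
qed

theorem proposition3p4:
  shows "(Hinf :: ('a::complex_banach \<Rightarrow> complex) set) \<subseteq> Bnat \<and>
    continuous_map
      (norm_topology (Hinf :: ('a \<Rightarrow> complex) set) sup_norm)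
      (norm_topology (Bnat :: ('a \<Rightarrow> complex) set) nat_Bloch_norm)
      id"
proof (rule conjI[OF Hinf_subset_Bnat])
  \<comment> \<open>The norm bound is applied to \<open>ball_diff f g\<close>, again in
    \<open>Hinf\<close>; since \<open>f\<close> and \<open>g\<close> lie in both spaces, neither
    metric is cut off to 0.\<close>
  have lip: "norm_metric Bnat nat_Bloch_norm f g \<le> 3 * norm_metric Hinf sup_norm f g"
    if "f \<in> Hinf" "g \<in> Hinf" for f g :: "'a \<Rightarrow> complex"
    using that Hinf_subset_Bnat nat_Bloch_norm_le_sup_norm[OF ball_diff_Hinf[OF that]]
    by (auto simp: norm_metric_def)
  show "continuous_map
      (norm_topology (Hinf :: ('a \<Rightarrow> complex) set) sup_norm)
      (norm_topology (Bnat :: ('a \<Rightarrow> complex) set) nat_Bloch_norm) id"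
    unfolding norm_topology_def
      Metric_space.metric_continuous_map[OF Metric_space_Hinf Metric_space_Bnat]
  proof (intro conjI ballI allI impI)
    show "id ` (Hinf :: ('a \<Rightarrow> complex) set) \<subseteq> Bnat" using Hinf_subset_Bnat by simp
    fix f :: "'a \<Rightarrow> complex" and e :: real
    assume "f \<in> Hinf" "0 < e"
    then show "\<exists>d>0. \<forall>g. g \<in> Hinf \<and> norm_metric Hinf sup_norm f g < d \<longrightarrow>
        norm_metric Bnat nat_Bloch_norm (id f) (id g) < e"
      using lip by (intro exI[of _ "e / 3"]) fastforce
  qed
qed

end
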